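(* Let $x$ and $k$ be indeterminates, let $K=\mathbb{Q}(x,k)$, and let $A_n^{(k)}(x)$, $n\ge 0$, be the $1/k$-Eulerian polynomials. Define polynomials $P_n^{(k)}(z)\in K[z]$ by $P_0^{(k)}(z)=1$, $P_1^{(k)}(z)=z-1$, and, for $n\ge 2$, $$P_n^{(k)}(z)=\bigl(z-(k(n-1)(1+x)+1)\bigr)P_{n-1}^{(k)}(z)-\bigl(k^2x(n^2-3n+2)+kx(n-1)\bigr)P_{n-2}^{(k)}(z).$$ Then $(P_n^{(k)}(z))_{n\ge 0}$ is a family of orthogonal polynomials over $K$ whose moments are the $1/k$-Eulerian polynomials $(A_n^{(k)}(x))_{n\ge 0}$.
   Context: The Savage-Viswanathan polynomials $F_n(x,y)$ are defined by the exponential generating function $\sum_{n\ge 0}F_n(x,y)\frac{z^n}{n!}=\left(\frac{1-x}{e^{z(x-1)}-x}\right)^y$ (a formal power series in $z$; the base has constant term $1$, and $u^y=\exp(y\ln u)$). They are polynomials in $x,y$. The $1/k$-Eulerian polynomials are $A_n^{(k)}(x)=k^nF_n(x,1/k)$. A sequence of monic polynomials $(p_n)_{n\ge0}$ over a field $K$ with $\deg p_n=n$ is (formally) orthogonal with moments $(\mu_n)_{n\ge 0}$ if the $K$-linear functional $\mathcal{L}$ on $K[z]$ with $\mathcal{L}(z^n)=\mu_n$ satisfies $\mathcal{L}(p_mp_n)=0$ for $m\neq n$ and $\mathcal{L}(p_n^2)\ne 0$ for all $n$. *)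

theory Defs
  imports Complex_Main "HOL-Computational_Algebra.Computational_Algebra"
begin

instance fract :: ("{idom, ring_char_0}") field_char_0
proof
  show "inj (of_nat :: nat \<Rightarrow> 'a fract)"
    by (rule injI) (simp add: of_nat_fract eq_fract)
qed

text \<open>
  The field \<open>\<rat>(x, k)\<close> is the fraction field of \<open>\<rat>[x][k]\<close>: the inner polynomial variable is \<open>x\<close>,
  the outer one is \<open>k\<close>.
\<close>

type_synonym rat_fun_xk = "rat poly poly fract"

definition indet_x :: rat_fun_xk where
  "indet_x = to_fract [:[:0, 1:]:]"

definition indet_k :: rat_fun_xk where
  "indet_k = to_fract [:0, 1:]"

text \<open>
  \<open>u\<^sup>y = exp (y ln u)\<close> for a power series \<open>u\<close> with constant term 1. Here \<^term>\<open>fps_ln 1\<close> is the series of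
  \<open>ln (1 + z)\<close>, so that \<open>ln u\<close> is its composition with \<open>u - 1\<close>.
\<close>

definition fps_pow :: "'a::field_char_0 fps \<Rightarrow> 'a \<Rightarrow> 'a fps" where
  "fps_pow u y = fps_compose (fps_exp 1) (fps_const y * fps_compose (fps_ln 1) (u - 1))"

text \<open>
  The value of \<open>F\<^sub>n(x, y)\<close> at elements \<open>x \<noteq> 1\<close> and \<open>y\<close> of a field of characteristic 0: the
  coefficients of the generating function at given \<open>x\<close> and \<open>y\<close> are the images of those at
  indeterminate \<open>x\<close> and \<open>y\<close>. For \<open>x = 1\<close> the base below is a division by a series with constant
  term 0, and the definition does not give the polynomial's value.
\<close>

definition savage_viswanathan :: "nat \<Rightarrow> 'a::field_char_0 \<Rightarrow> 'a \<Rightarrow> 'a" where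
  "savage_viswanathan n x y =
     fact n * fps_nth (fps_pow (fps_const (1 - x) / (fps_exp (x - 1) - fps_const x)) y) n"

definition eulerian_1k :: "'a::field_char_0 \<Rightarrow> nat \<Rightarrow> 'a \<Rightarrow> 'a" where
  "eulerian_1k k n x = k ^ n * savage_viswanathan n x (1 / k)"

definition formally_orthogonal :: "(nat \<Rightarrow> 'a::field poly) \<Rightarrow> (nat \<Rightarrow> 'a) \<Rightarrow> bool" where
  "formally_orthogonal p \<mu> \<longleftrightarrow>
     (\<forall>n. degree (p n) = n \<and> lead_coeff (p n) = 1) \<and>
     (\<exists>L. Vector_Spaces.linear smult (*) L \<and> (\<forall>n. L (monom 1 n) = \<mu> n) \<and>
          (\<forall>m n. m \<noteq> n \<longrightarrow> L (p m * p n) = 0) \<and> (\<forall>n. L (p n * p n) \<noteq> 0))"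

fun P_poly :: "'a::field \<Rightarrow> 'a \<Rightarrow> nat \<Rightarrow> 'a poly" where
  "P_poly x k 0 = 1"
| "P_poly x k (Suc 0) = [:0, 1:] - 1"
| "P_poly x k (Suc (Suc m)) = (let n = of_nat (Suc (Suc m)) in
     ([:0, 1:] - [:k * (n - 1) * (1 + x) + 1:]) * P_poly x k (Suc m)
     - [:k\<^sup>2 * x * (n\<^sup>2 - 3 * n + 2) + k * x * (n - 1):] * P_poly x k m)"

end

theory Submission
  imports Defs
begin

text \<open>
  Let \<open>G\<close> be the generating function of the \<open>F\<^sub>n(x, 1/k)\<close>, \<open>V\<close> the logarithmic derivative of
  \<open>(1 - x) / (e\<^bsup>z(x-1)\<^esup> - x)\<close> and \<open>h = (V - 1) / (k x)\<close>. Then \<open>k G' = G (1 + k x h)\<close> and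
  \<open>k h' = (1 + k h) (1 + k x h)\<close>. With \<open>c\<^sub>m = \<Prod>\<^bsub>i<m\<^esub> k x (k i + 1)\<close> the series
  \<open>g\<^sub>m = c\<^sub>m G h\<^sup>m\<close> therefore satisfy \<open>k g\<^sub>m' = g\<^bsub>m+1\<^esub> + b\<^sub>m g\<^sub>m + \<lambda>\<^sub>m g\<^bsub>m-1\<^esub>\<close>, where \<open>b\<^sub>m\<close> and \<open>\<lambda>\<^sub>m\<close>
  are the coefficients of the three-term recurrence. Hence \<open>L (z\<^sup>n P\<^sub>m) = n! k\<^sup>n [t\<^sup>n] g\<^sub>m\<close>, by
  induction on \<open>m\<close>; as \<open>h\<close> has no constant term, this vanishes for \<open>n < m\<close> and not for \<open>n = m\<close>.
\<close>

section \<open>The moment functional\<close>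

text \<open>The witness for the functional \<open>L\<close> in
  \<open>formally_orthogonal\<close>.\<close>

definition moment_functional :: "(nat \<Rightarrow> 'a::field) \<Rightarrow> 'a poly \<Rightarrow> 'a" where
  "moment_functional \<mu> p = (\<Sum>i\<le>degree p. coeff p i * \<mu> i)"

text \<open>Coefficients above the degree vanish, so polynomials of different degrees can share one
  summation range.\<close>

lemma moment_functional_eq_sum:
  assumes "degree p \<le> N"
  shows "moment_functional \<mu> p = (\<Sum>i\<le>N. coeff p i * \<mu> i)"
  unfolding moment_functional_def
  by (rule sum.mono_neutral_left) (use assms in \<open>auto simp: coeff_eq_0\<close>)

lemma moment_functional_add:
  "moment_functional \<mu> (p + q) = moment_functional \<mu> p + moment_functional \<mu> q"
proof -
  let ?N = "max (degree p) (degree q)"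
  have "degree (p + q) \<le> ?N"
    by (rule degree_add_le_max)
  then show ?thesis
    by (simp add: moment_functional_eq_sum[where N = ?N] sum.distrib algebra_simps)
qed

lemma moment_functional_smult:
  "moment_functional \<mu> (smult c p) = c * moment_functional \<mu> p"
  by (simp add: moment_functional_eq_sum[OF degree_smult_le] moment_functional_def
      sum_distrib_left mult.assoc)

lemma moment_functional_diff:
  "moment_functional \<mu> (p - q) = moment_functional \<mu> p - moment_functional \<mu> q"
  using moment_functional_add[of \<mu> p "smult (-1) q"] moment_functional_smult[of \<mu> "-1" q]
  by simp

lemma moment_functional_sum:
  "moment_functional \<mu> (\<Sum>i\<in>A. f i) = (\<Sum>i\<in>A. moment_functional \<mu> (f i))"
  by (induction A rule: infinite_finite_induct)
    (simp_all add: moment_functional_add, simp_all add: moment_functional_def)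

lemma moment_functional_monom: "moment_functional \<mu> (monom 1 n) = \<mu> n"
proof -
  have "moment_functional \<mu> (monom 1 n) = (\<Sum>i\<le>n. coeff (monom 1 n) i * \<mu> i)"
    by (rule moment_functional_eq_sum) (rule degree_monom_le)
  also have "\<dots> = (\<Sum>i\<le>n. if i = n then \<mu> i else 0)"
    by (rule sum.cong) auto
  finally show ?thesis by simp
qed

lemma linear_moment_functional: "Vector_Spaces.linear smult (*) (moment_functional \<mu>)"
proof (unfold_locales)
qed (simp_all add: algebra_simps smult_add_left smult_add_right
      moment_functional_add moment_functional_smult)

lemma moment_functional_mult_eq:
  "moment_functional \<mu> (q * p) =
    (\<Sum>i\<le>degree q. coeff q i * moment_functional \<mu> (monom 1 i * p))"
proof -
  have "q * p = (\<Sum>i\<le>degree q. smult (coeff q i) (monom 1 i * p))"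
    by (subst (1) poly_as_sum_of_monoms[of q, symmetric])
      (simp add: sum_distrib_right smult_monom flip: mult_smult_left)
  then show ?thesis
    by (simp add: moment_functional_sum moment_functional_smult)
qed

text \<open>Testing against monomials suffices: the factor of lower degree is a combination of
  monomials \<open>monom 1 i\<close> with \<open>i < m\<close>, and in \<open>p n * p n\<close> only
  the top monomial survives, with coefficient 1.\<close>

lemma formally_orthogonalI:
  fixes p :: "nat \<Rightarrow> 'a::field poly"
  assumes deg: "\<And>n. degree (p n) = n" and monic: "\<And>n. lead_coeff (p n) = 1"
    and zero: "\<And>m n. n < m \<Longrightarrow> moment_functional \<mu> (monom 1 n * p m) = 0"
    and nonzero: "\<And>m. moment_functional \<mu> (monom 1 m * p m) \<noteq> 0"
  shows "formally_orthogonal p \<mu>"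
proof -
  have less: "moment_functional \<mu> (p m * p n) = 0" if "m < n" for m n
    using that by (subst moment_functional_mult_eq) (simp add: deg zero)
  have neq: "moment_functional \<mu> (p m * p n) = 0" if "m \<noteq> n" for m n
    using less[of m n] less[of n m] that by (cases "m < n") (auto simp: mult.commute)
  have eq: "moment_functional \<mu> (p n * p n) \<noteq> 0" for n
  proof -
    have "moment_functional \<mu> (p n * p n) = moment_functional \<mu> (monom 1 n * p n)"
      using monic[of n]
      by (subst moment_functional_mult_eq) (simp add: deg zero lessThan_Suc_atMost[symmetric])
    with nonzero show ?thesis by simp
  qed
  show ?thesis
    unfolding formally_orthogonal_def
    using deg monic linear_moment_functional[of \<mu>] moment_functional_monom[of \<mu>] neq eq by blast
qed

section \<open>The recurrence\<close>

text \<open>At index \<open>n = m + 2\<close> the quadratic n^2 - 3n + 2 factors as (m + 1) m, which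
  exposes the ratio \<open>c (Suc m) / c m\<close> in the last coefficient.\<close>

lemma P_poly_Suc_Suc:
  "P_poly x k (Suc (Suc m)) =
    [:- (k * of_nat (Suc m) * (1 + x) + 1), 1:] * P_poly x k (Suc m)
    - smult (of_nat (Suc m) * (k * x * (k * of_nat m + 1))) (P_poly x k m)"
proof -
  have 1: "(of_nat (Suc (Suc m)) :: 'a) - 1 = of_nat (Suc m)" by simp
  have 2: "k\<^sup>2 * x * ((of_nat (Suc (Suc m)))\<^sup>2 - 3 * of_nat (Suc (Suc m)) + 2)
      + k * x * of_nat (Suc m) = of_nat (Suc m) * (k * x * (k * of_nat m + 1))"
    by (simp add: algebra_simps power2_eq_square)
  show ?thesis
    unfolding P_poly.simps Let_def 1 2 by simp
qed

lemma P_poly_monic: "degree (P_poly x k n) = n \<and> lead_coeff (P_poly x k n) = 1"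
proof (induction x k n rule: P_poly.induct)
  case (2 x k)
  have "P_poly x k (Suc 0) = [:-1, 1:]" by (simp add: one_pCons)
  then show ?case by simp
next
  case (3 x k m)
  let ?P = "P_poly x k"
  let ?A = "[:- (k * of_nat (Suc m) * (1 + x) + 1), 1:] * ?P (Suc m)"
  let ?B = "smult (of_nat (Suc m) * (k * x * (k * of_nat m + 1))) (?P m)"
  from 3 have IH: "degree (?P (Suc m)) = Suc m" "lead_coeff (?P (Suc m)) = 1" "degree (?P m) = m"
    by (metis, metis, metis)
  have "?P (Suc m) \<noteq> 0" using IH by auto
  then have A: "degree ?A = Suc (Suc m)" "coeff ?A (Suc (Suc m)) = 1"
    using IH degree_mult_eq[of "[:- (k * of_nat (Suc m) * (1 + x) + 1), 1:]" "?P (Suc m)"]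
      lead_coeff_mult[of "[:- (k * of_nat (Suc m) * (1 + x) + 1), 1:]" "?P (Suc m)"]
    by (simp_all del: mult_pCons_left P_poly.simps)
  have B: "degree ?B \<le> m" using degree_smult_le[of _ "?P m"] IH by metis
  have "degree (?A - ?B) \<le> Suc (Suc m)"
    using A B by (intro degree_diff_le) linarith+
  moreover have c: "coeff (?A - ?B) (Suc (Suc m)) = 1"
    unfolding coeff_diff coeff_smult
    using A IH(3) coeff_eq_0[of "?P m" "Suc (Suc m)"] by simp
  ultimately have "degree (?A - ?B) = Suc (Suc m)"
    by (metis le_antisym le_degree zero_neq_one)
  with c show ?case unfolding P_poly_Suc_Suc by simp
qed auto

section \<open>The generating function\<close>

text \<open>Chain rule: the derivative 1 / (1 + X) of ln (1 + X), composed with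
  \<open>u - 1\<close>, is \<open>inverse u\<close>.\<close>

lemma fps_deriv_fps_pow:
  fixes u :: "'a::field_char_0 fps"
  assumes "fps_nth u 0 = 1"
  shows "fps_deriv (fps_pow u y) = fps_const y * (fps_pow u y * (inverse u * fps_deriv u))"
proof -
  have [simp]: "fps_nth (fps_ln (1::'a)) 0 = 0" by (simp add: fps_ln_def)
  have "(inverse (1 + fps_X) oo (u - 1)) = inverse ((1 + fps_X) oo (u - 1))"
    using assms by (intro fps_inverse_compose) auto
  also have "\<dots> = inverse u"
    using assms by (simp add: fps_compose_add_distrib)
  finally have inv: "(inverse (1 + fps_X) oo (u - 1)) = inverse u" .
  show ?thesis
    using assms unfolding fps_pow_def
    by (simp add: fps_compose_deriv fps_ln_deriv inv mult_ac)
qed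

lemma fps_pow_nth_0: "fps_nth (fps_pow u y) 0 = 1"
  by (simp add: fps_pow_def)

text \<open>With E = exp (z (x - 1)), the logarithmic derivative is V = (1 - x) E / (E - x), which
  solves a Riccati equation. The constant term 1 - x of E - x is invertible because
  \<open>x \<noteq> 1\<close>.\<close>

lemma sv_base_ode:
  fixes x :: "'a::field_char_0"
  assumes "x \<noteq> 1"
  defines "u \<equiv> fps_const (1 - x) / (fps_exp (x - 1) - fps_const x)"
  defines "V \<equiv> inverse u * fps_deriv u"
  shows "fps_nth u 0 = 1" "fps_nth V 0 = 1" "fps_deriv V = V * (V + fps_const (x - 1))"
proof -
  define E where "E = fps_exp (x - 1)"
  define I where "I = inverse (E - fps_const x)"
  have E0: "fps_nth (E - fps_const x) 0 \<noteq> 0" "fps_nth E 0 = 1"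
    using assms(1) by (simp_all add: E_def)
  have I: "(E - fps_const x) * I = 1"
    unfolding I_def using E0 by (simp add: inverse_mult_eq_1')
  have u: "u = fps_const (1 - x) * I"
    unfolding u_def I_def E_def[symmetric] using E0 by (simp add: fps_divide_unit)
  have E': "fps_deriv E = fps_const (x - 1) * E"
    unfolding E_def by simp
  have I': "fps_deriv I = - (fps_const (x - 1) * E * I\<^sup>2)"
    unfolding I_def using E0 by (subst fps_inverse_deriv) (simp_all add: E')
  have inv_u: "inverse u = inverse (fps_const (1 - x)) * (E - fps_const x)"
    unfolding u I_def using E0 by (simp add: fps_inverse_mult)
  have neg: "fps_const (x - 1) = - fps_const (1 - x)" by simp
  have inv: "inverse (fps_const (1 - x)) * fps_const (1 - x) = 1"
    using assms(1) by (simp add: fps_const_inverse)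
  have u': "fps_deriv u = fps_const (1 - x) * fps_deriv I"
    unfolding u by simp
  have "V = (inverse (fps_const (1 - x)) * fps_const (1 - x)) * fps_const (1 - x)
      * E * I * ((E - fps_const x) * I)"
    unfolding V_def inv_u u' I' neg power2_eq_square
    by (simp only: mult_ac mult_minus_left mult_minus_right minus_minus)
  also have "\<dots> = fps_const (1 - x) * E * I"
    unfolding I inv by simp
  finally have V: "V = fps_const (1 - x) * E * I" .
  have I0: "fps_nth I 0 = inverse (1 - x)"
    by (simp add: I_def E_def)
  show "fps_nth u 0 = 1" "fps_nth V 0 = 1"
    using assms(1) unfolding u V by (simp_all add: I0 E0)
  have "fps_deriv V = fps_const (1 - x) * (fps_const (x - 1) * E * I
      - fps_const (x - 1) * E\<^sup>2 * I\<^sup>2)"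
    unfolding V by (simp add: E' I' power2_eq_square algebra_simps)
  moreover have "V * (V + fps_const (x - 1)) = fps_const (1 - x) * (fps_const (x - 1) * E * I
      + fps_const (1 - x) * E\<^sup>2 * I\<^sup>2)"
    unfolding V by (simp add: power2_eq_square algebra_simps)
  ultimately show "fps_deriv V = V * (V + fps_const (x - 1))"
    unfolding neg by (simp only: mult_minus_left diff_minus_eq_add)
qed

section \<open>The moments\<close>

text \<open>Only the lowest coefficients of \<open>G\<close> and \<open>h\<close> matter for
  orthogonality, so the two series are obtained abstractly.\<close>

lemma moment_functional_P_poly:
  fixes x k :: "'a::field_char_0"
  assumes nz: "x \<noteq> 0" "x \<noteq> 1" "k \<noteq> 0"
  defines "\<mu> \<equiv> (\<lambda>n. eulerian_1k k n x)"
  defines "c \<equiv> (\<lambda>m. \<Prod>i<m. k * x * (k * of_nat i + 1))"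
  obtains G h where "fps_nth G 0 = 1" "fps_nth h 0 = 0" "k * fps_nth h 1 = 1"
    "\<And>m n. moment_functional \<mu> (monom 1 n * P_poly x k m)
      = fact n * k ^ n * (c m * fps_nth (G * h ^ m) n)"
proof -
  define u where "u = fps_const (1 - x) / (fps_exp (x - 1) - fps_const x)"
  define V where "V = inverse u * fps_deriv u"
  define G where "G = fps_pow u (1 / k)"
  define h where "h = fps_const (1 / (k * x)) * (V - 1)"
  note ode = sv_base_ode[OF nz(2), folded u_def, folded V_def]
  have G0: "fps_nth G 0 = 1" unfolding G_def by (rule fps_pow_nth_0)
  have h0: "fps_nth h 0 = 0" using ode by (simp add: h_def)
  have V_h: "V = 1 + fps_const (k * x) * h"
    using nz by (simp add: h_def mult.assoc[symmetric])
  have G': "fps_const k * fps_deriv G = G * (1 + fps_const (k * x) * h)"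
    unfolding V_h[symmetric] V_def unfolding G_def fps_deriv_fps_pow[OF ode(1)]
    using nz by (simp add: mult.assoc[symmetric])
  have h': "fps_const k * fps_deriv h
      = (1 + fps_const k * h) * (1 + fps_const (k * x) * h)"
  proof -
    have "fps_const (k * x) * fps_deriv h = fps_deriv V"
      unfolding V_h by simp
    \<comment> \<open>Here V + x - 1 = x (1 + k h); the factor x is cancelled at the end.\<close>
    also have "\<dots> = (1 + fps_const (k * x) * h)
        * (fps_const x + fps_const (k * x) * h)"
      unfolding ode(3) unfolding V_h by (simp add: algebra_simps flip: fps_const_sub)
    also have "\<dots> = fps_const x * ((1 + fps_const k * h) * (1 + fps_const (k * x) * h))"
      by (simp add: algebra_simps flip: fps_const_mult)
    finally have "fps_const x * (fps_const k * fps_deriv h)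
        = fps_const x * ((1 + fps_const k * h) * (1 + fps_const (k * x) * h))"
      by (simp add: mult_ac flip: fps_const_mult)
    then show ?thesis using nz by simp
  qed
  have h1: "k * fps_nth h 1 = 1"
    using arg_cong[OF h', of "\<lambda>f. fps_nth f 0"] h0 by simp
  define g where "g = (\<lambda>m. fps_const (c m) * (G * h ^ m))"
  have c_Suc: "c (Suc m) = c m * (k * x * (k * of_nat m + 1))" for m
    by (simp add: c_def)
  have g_0: "fps_const k * fps_deriv (g 0) = g 1 + g 0"
    using G' by (simp add: g_def c_def algebra_simps)
  have g_Suc: "fps_const k * fps_deriv (g (Suc m)) = g (Suc (Suc m))
      + fps_const (k * of_nat (Suc m) * (1 + x) + 1) * g (Suc m)
      + fps_const (of_nat (Suc m) * (k * x * (k * of_nat m + 1))) * g m" for m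
  proof -
    let ?s = "fps_const (of_nat (Suc m)) :: 'a fps"
    let ?a = "fps_const (k * x * (k * of_nat m + 1))"
    have power: "fps_deriv (h ^ Suc m) = ?s * fps_deriv h * h ^ m"
      unfolding fps_deriv_power by simp
    have "fps_const k * fps_deriv (g (Suc m)) = fps_const (c (Suc m)) *
        ((fps_const k * fps_deriv G) * h ^ Suc m + G * (?s * (fps_const k * fps_deriv h) * h ^ m))"
      by (simp add: g_def power algebra_simps del: power_Suc of_nat_Suc)
    also have "\<dots> = fps_const (c m) * ?a *
        (G * (1 + fps_const (k * x) * h) * h ^ Suc m
          + G * (?s * ((1 + fps_const k * h) * (1 + fps_const (k * x) * h)) * h ^ m))"
      by (simp only: G' h' c_Suc fps_const_mult)
    \<comment> \<open>Collecting powers of h in the bracket: \<open>h ^ (m + 2)\<close> has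
      coefficient k x (k (m + 1) + 1), which is \<open>c (m + 2) / c (m + 1)\<close>;
      \<open>h ^ (m + 1)\<close> has 1 + (m + 1) k (1 + x); \<open>h ^ m\<close> has m + 1, and the
      prefactor supplies the rest of the last coefficient.\<close>
    also have "\<dots> = g (Suc (Suc m))
        + fps_const (k * of_nat (Suc m) * (1 + x) + 1) * g (Suc m)
        + fps_const (of_nat (Suc m) * (k * x * (k * of_nat m + 1))) * g m"
      unfolding g_def c_Suc
      by (simp add: algebra_simps flip: fps_const_mult fps_const_add)
    finally show ?thesis .
  qed
  \<comment> \<open>Raising the exponent of the monomial by one corresponds to applying k d/dt to
    the series.\<close>
  have step: "fact (Suc n) * k ^ Suc n * fps_nth f (Suc n)
      = fact n * k ^ n * fps_nth (fps_const k * fps_deriv f) n" for f :: "'a fps" and n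
    by (simp add: algebra_simps)
  have base: "moment_functional \<mu> (monom 1 n) = fact n * k ^ n * fps_nth (g 0) n" for n
    by (simp add: moment_functional_monom \<mu>_def eulerian_1k_def savage_viswanathan_def
        g_def c_def G_def u_def)
  \<comment> \<open>The exponent n stays arbitrary because the recurrence multiplies by z and so
    calls the hypothesis at \<open>Suc n\<close>. Subtracting the two lower terms in
    \<open>g_Suc\<close> then leaves exactly the next series.\<close>
  have main: "moment_functional \<mu> (monom 1 n * P_poly x k m) = fact n * k ^ n * fps_nth (g m) n"
    for m n
  proof (induction m arbitrary: n rule: induct_nat_012)
    case 0
    show ?case by (simp add: base)
  next
    case 1
    have "monom 1 n * P_poly x k 1 = monom 1 (Suc n) - monom 1 n"
      by (simp add: monom_Suc algebra_simps)
    then have "moment_functional \<mu> (monom 1 n * P_poly x k 1)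
        = fact n * k ^ n * (fps_nth (fps_const k * fps_deriv (g 0)) n - fps_nth (g 0) n)"
      unfolding right_diff_distrib step[symmetric] by (simp only: moment_functional_diff base)
    then show ?case by (simp add: g_0)
  next
    case (ge2 m)
    let ?b = "k * of_nat (Suc m) * (1 + x) + 1"
    let ?l = "of_nat (Suc m) * (k * x * (k * of_nat m + 1))"
    have lin: "[:- b, 1:] * p = monom 1 1 * p - smult b p" for b :: 'a and p
      by (simp add: monom_Suc)
    have "monom 1 n * P_poly x k (Suc (Suc m)) = monom 1 (Suc n) * P_poly x k (Suc m)
        - smult ?b (monom 1 n * P_poly x k (Suc m)) - smult ?l (monom 1 n * P_poly x k m)"
      unfolding P_poly_Suc_Suc lin right_diff_distrib mult_smult_right mult.assoc[symmetric]
        mult_monom by simp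
    then have "moment_functional \<mu> (monom 1 n * P_poly x k (Suc (Suc m)))
        = fact n * k ^ n * (fps_nth (fps_const k * fps_deriv (g (Suc m))) n
          - ?b * fps_nth (g (Suc m)) n - ?l * fps_nth (g m) n)"
      unfolding right_diff_distrib step[symmetric]
      by (simp only: moment_functional_diff moment_functional_smult ge2.IH mult_ac)
    then show ?case
      unfolding g_Suc by (simp only: fps_add_nth fps_mult_left_const_nth) simp
  qed
  show thesis
    using that[OF G0 h0 h1] main unfolding g_def fps_mult_left_const_nth by blast
qed

text \<open>The conditions \<open>k * of_nat i + 1 \<noteq> 0\<close>, with x and k nonzero, keep
  the product in front of \<open>G * h ^ m\<close> nonzero, hence also
  \<open>L (p m * p m)\<close>.\<close>

theorem formally_orthogonal_P_poly:
  fixes x k :: "'a::field_char_0"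
  assumes nz: "x \<noteq> 0" "x \<noteq> 1" "k \<noteq> 0" and k: "\<And>i::nat. k * of_nat i + 1 \<noteq> 0"
  shows "formally_orthogonal (P_poly x k) (\<lambda>n. eulerian_1k k n x)"
proof -
  obtain G h where Gh: "fps_nth G 0 = 1" "fps_nth h 0 = 0" "k * fps_nth h 1 = 1"
    and main: "\<And>m n. moment_functional (\<lambda>n. eulerian_1k k n x) (monom 1 n * P_poly x k m)
      = fact n * k ^ n * ((\<Prod>i<m. k * x * (k * of_nat i + 1)) * fps_nth (G * h ^ m) n)"
    using moment_functional_P_poly[OF nz] by metis
  have low: "fps_nth (h ^ m) n = 0" if "n < m" for m n
    using startsby_zero_power_prefix[OF Gh(2)] that by blast
  have "fps_nth (h ^ m) m = fps_nth h 1 ^ m" for m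
    by (rule startsby_zero_power_nth_same[OF Gh(2)])
  \<comment> \<open>Since \<open>h ^ m\<close> starts at degree m, the Cauchy product reduces to the
    constant term of G times \<open>fps_nth h 1 ^ m\<close>.\<close>
  then have diag: "fps_nth (G * h ^ m) m \<noteq> 0" for m
    using Gh low unfolding fps_mult_nth
    by (subst sum.remove[of _ 0]) (auto intro!: sum.neutral)
  have zero: "fps_nth (G * h ^ m) n = 0" if "n < m" for m n
    using that by (auto simp: fps_mult_nth low intro!: sum.neutral)
  show ?thesis
  proof (rule formally_orthogonalI)
    show "degree (P_poly x k n) = n" "lead_coeff (P_poly x k n) = 1" for n
      using P_poly_monic by blast+
  qed (use nz k zero diag in \<open>simp_all add: main\<close>)
qed

theorem corollary2:
  shows "formally_orthogonal (P_poly indet_x indet_k)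
           (\<lambda>n. eulerian_1k indet_k n indet_x)"
proof (rule formally_orthogonal_P_poly)
  show "indet_x \<noteq> 0" "indet_k \<noteq> 0"
    by (simp_all add: indet_x_def indet_k_def)
  show "indet_x \<noteq> 1"
    unfolding indet_x_def to_fract_1[symmetric] by (simp add: one_pCons)
  \<comment> \<open>As a polynomial in k this has constant coefficient 1, so it is not zero.\<close>
  show "indet_k * of_nat i + 1 \<noteq> 0" for i
  proof -
    have "indet_k * of_nat i + 1 = to_fract ([:0, 1:] * of_nat i + 1)"
      by (simp add: indet_k_def to_fract_def of_nat_fract One_fract_def)
    moreover have "coeff ([:0, 1:] * of_nat i + 1 :: rat poly poly) 0 = 1"
      by simp
    ultimately show ?thesis by (metis coeff_0 to_fract_eq_0_iff zero_neq_one)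
  qed
qed

end
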